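(* Let $d\ge 2$, $T\ge 1$ be integers, $D,G>0$, $\mathcal{D}=\{\mathbf{w}\in\mathbb{R}^d:\|\mathbf{w}\|\le D/2\}$, and let $S\in[0,DT]$ be a switching cost budget. For any online algorithm of the player with budget $S$ (i.e. whose actions $\mathbf{w}_1,\dots,\mathbf{w}_T\in\mathcal{D}$ always satisfy $\sum_{t=2}^T\|\mathbf{w}_t-\mathbf{w}_{t-1}\|\le S$), the Adversary's Policy described in the context can, for a suitable choice of its parameter $c>0$, generate a series of loss functions $f_1,\dots,f_T:\mathcal{D}\to\mathbb{R}$ that are linear, of the form $f_t(\mathbf{w})=\mathbf{m}_t^\top\mathbf{w}$ with $\|\mathbf{m}_t\|=G$ (so that $\max_{\mathbf{w}\in\mathcal{D}}\|\nabla f_t(\mathbf{w})\|\le G$ for all $t$), such that the regret $$R=\sum_{t=1}^T f_t(\mathbf{w}_t)-\min_{\mathbf{w}\in\mathcal{D}}\sum_{t=1}^T f_t(\mathbf{w})$$ satisfies $$R\ \ge\ \begin{cases}0.5\,DG\sqrt{T}, & S\in[D\sqrt{T},DT],\\[2pt] 0.05\,DG\,\dfrac{DT}{S}, & S\in[D,D\sqrt{T}),\\[4pt] 0.05\,DGT, & S\in[0,D).\end{cases}$$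
   Context: $\|\cdot\|$ is the Euclidean norm. Online convex optimization with continuous switching constraint: in each round $t=1,\dots,T$ the player selects $\mathbf{w}_t\in\mathcal{D}$ using only the past loss functions $f_1,\dots,f_{t-1}$ (and past actions); then the adversary, having observed $\mathbf{w}_1,\dots,\mathbf{w}_t$, reveals a loss $f_t:\mathcal{D}\to\mathbb{R}$, and the player suffers $f_t(\mathbf{w}_t)$. The player must keep $\sum_{t=2}^T\|\mathbf{w}_t-\mathbf{w}_{t-1}\|\le S$, where $S$ is a given budget. Adversary's Policy (parameter $c>0$). All vectors $\mathbf{m}_t\in\mathbb{R}^d$ chosen have $\|\mathbf{m}_t\|=G$, and the loss in round $t$ is $f_t(\mathbf{w})=\mathbf{m}_t^\top\mathbf{w}$. 1. Set $\tau=1$, $l_1=1$. Observe $\mathbf{w}_1$ and choose $\mathbf{m}_1$ with $\mathbf{m}_1^\top\mathbf{w}_1=0$. 2. For $t=2,\dots,T$: observe $\mathbf{w}_t$. If $\sum_{j=l_\tau+1}^t\|\mathbf{w}_j-\mathbf{w}_{j-1}\|\le \frac{c}{S}$, set $\mathbf{m}_t=\mathbf{m}_{t-1}$. Otherwise choose $\mathbf{m}_t$ with $\mathbf{m}_t^\top\mathbf{w}_t\ge 0$ and $\mathbf{m}_t^\top\big(\sum_{j=1}^{t-1}\mathbf{m}_j\big)\ge 0$, then replace $\tau$ by $\tau+1$ and set $l_\tau=t$ (a new epoch starts at round $t$). If $S=0$, the threshold $c/S$ is read as $+\infty$ (the player never moves and $\mathbf{m}_t=\mathbf{m}_1$ for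 all $t$). *)

theory Defs
  imports "HOL-Analysis.Analysis"
begin

type_synonym 'v loss = "'v \<Rightarrow> real"

text \<open>
  A (deterministic) online algorithm maps the past losses and its own past actions, both oldest
  first, to its next action.  Losses are total functions; only their values on the feasible
  ball enter the regret.
\<close>

type_synonym 'v player = "'v loss list \<Rightarrow> 'v list \<Rightarrow> 'v"

text \<open>Rounds are numbered from 1, so the argument 0 of \<open>actions\<close> has no meaning.\<close>

fun actions :: "'v player \<Rightarrow> (nat \<Rightarrow> 'v loss) \<Rightarrow> nat \<Rightarrow> 'v" where
  "actions A f t = A (map f [1..<t]) (map (\<lambda>s. actions A f s) [1..<t])"

declare actions.simps [simp del]

definition feasible :: "real \<Rightarrow> 'v::euclidean_space set" where
  "feasible D = cball 0 (D / 2)"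

definition movement :: "(nat \<Rightarrow> 'v::real_normed_vector) \<Rightarrow> nat \<Rightarrow> nat \<Rightarrow> real" where
  "movement w l t = (\<Sum>j=l+1..t. norm (w j - w (j - 1)))"

text \<open>The constraints must hold whatever convex losses the adversary reveals.\<close>

definition budgeted_player :: "real \<Rightarrow> real \<Rightarrow> nat \<Rightarrow> 'v::euclidean_space player \<Rightarrow> bool" where
  "budgeted_player D S T A \<longleftrightarrow>
     (\<forall>f. (\<forall>t\<in>{1..T}. convex_on (feasible D) (f t)) \<longrightarrow>
        (\<forall>t\<in>{1..T}. actions A f t \<in> feasible D) \<and> movement (actions A f) 1 T \<le> S)"

text \<open>The threshold \<open>c / S\<close> stands for plus infinity when \<open>S = 0\<close>.\<close>

definition within_threshold :: "real \<Rightarrow> real \<Rightarrow> real \<Rightarrow> bool" where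
  "within_threshold c S x \<longleftrightarrow> S = 0 \<or> x \<le> c / S"

text \<open>
  \<open>epoch_start c S w t\<close> is the first round of the epoch that contains round \<open>t\<close>, i.e. the
  value of \<open>l\<^sub>\<tau>\<close> once round \<open>t\<close> has been processed; round 0 does not exist.
\<close>

fun epoch_start :: "real \<Rightarrow> real \<Rightarrow> (nat \<Rightarrow> 'v::real_normed_vector) \<Rightarrow> nat \<Rightarrow> nat" where
  "epoch_start c S w 0 = 1"
| "epoch_start c S w (Suc 0) = 1"
| "epoch_start c S w (Suc (Suc n)) =
     (let l = epoch_start c S w (Suc n)
      in if within_threshold c S (movement w l (Suc (Suc n))) then l else Suc (Suc n))"

text \<open>
  The policy leaves some freedom in the choice of each vector, so it is a relation between the
  observed actions \<open>w\<close> and the chosen vectors \<open>m\<close>.  The condition on \<open>m t\<close> involves only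
  \<open>w\<close> up to round \<open>t\<close> and \<open>m\<close> before round \<open>t\<close>.
\<close>

definition follows_adversary_policy ::
    "real \<Rightarrow> real \<Rightarrow> real \<Rightarrow> nat \<Rightarrow> (nat \<Rightarrow> 'v::real_inner) \<Rightarrow> (nat \<Rightarrow> 'v) \<Rightarrow> bool" where
  "follows_adversary_policy c G S T w m \<longleftrightarrow>
     (\<forall>t\<in>{1..T}. norm (m t) = G) \<and>
     m 1 \<bullet> w 1 = 0 \<and>
     (\<forall>t\<in>{2..T}.
        if within_threshold c S (movement w (epoch_start c S w (t - 1)) t)
        then m t = m (t - 1)
        else m t \<bullet> w t \<ge> 0 \<and> m t \<bullet> (\<Sum>j=1..t-1. m j) \<ge> 0)"

text \<open>
  For the continuous losses considered here the infimum over the compact ball is a minimum.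
\<close>

definition regret ::
    "real \<Rightarrow> nat \<Rightarrow> (nat \<Rightarrow> 'v::euclidean_space loss) \<Rightarrow> (nat \<Rightarrow> 'v) \<Rightarrow> real" where
  "regret D T f w =
     (\<Sum>t=1..T. f t (w t)) - (INF u\<in>feasible D. \<Sum>t=1..T. f t u)"

end

theory Submission imports Defs begin

text \<open>
  Let \<open>M = m\<^sub>1 + \<dots> + m\<^sub>T\<close>.  The regret against linear losses is
  \<open>(\<Sum>t. m\<^sub>t \<bullet> w\<^sub>t) + (D / 2) \<parallel>M\<parallel>\<close>.  Inside an epoch the player stays within \<open>c / S\<close> of a point
  where the current loss is nonnegative, so every loss is at least \<open>- G c / S\<close>.  Since each epoch's
  vector makes a nonnegative inner product with the sum of all earlier vectors, \<open>\<parallel>M\<parallel>\<^sup>2\<close> is at least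
  \<open>G\<^sup>2\<close> times the sum of the squared epoch lengths.  Every finished epoch consumes more than \<open>c / S\<close>
  of the budget, so there are at most \<open>1 + S\<^sup>2 / c\<close> epochs, and by Cauchy-Schwarz
  \<open>\<parallel>M\<parallel> \<ge> G T / sqrt (1 + S\<^sup>2 / c)\<close>.  For \<open>S < D sqrt T\<close> a suitable \<open>c\<close> balances the two terms.  For
  \<open>S \<ge> D sqrt T\<close> take \<open>c\<close> tiny: either all epochs have length 1 and no loss is negative, or the
  sum of squared lengths is at least \<open>T + 2\<close>, which outweighs the negative losses.
\<close>

section \<open>Movement and epochs\<close>

lemma movement_same [simp]: "movement w l l = 0"
  by (simp add: movement_def)

lemma movement_Suc:
  "l \<le> t \<Longrightarrow> movement w l (Suc t) = movement w l t + norm (w (Suc t) - w t)"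
  by (simp add: movement_def)

lemma movement_nonneg [simp]: "0 \<le> movement w l t"
  by (simp add: movement_def sum_nonneg)

lemma movement_add:
  assumes "l \<le> k" "k \<le> t"
  shows "movement w l k + movement w k t = movement w l t"
  using assms(2,1) by (induction rule: dec_induct) (simp_all add: movement_Suc)

lemma movement_mono:
  assumes "k \<le> l" "l \<le> s" "s \<le> t"
  shows "movement w l s \<le> movement w k t"
proof -
  have "movement w k t = movement w k l + (movement w l s + movement w s t)"
    using assms by (simp add: movement_add)
  then show ?thesis
    using movement_nonneg[of w k l] movement_nonneg[of w s t] by linarith
qed

lemma norm_diff_le_movement:
  assumes "l \<le> t"
  shows "norm (w t - w l) \<le> movement w l t"
  using assms
proof (induction rule: dec_induct)
  case base
  show ?case by simp
next
  case (step n)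
  have "norm (w (Suc n) - w l) \<le> norm (w (Suc n) - w n) + norm (w n - w l)"
    using norm_triangle_ineq[of "w (Suc n) - w n" "w n - w l"] by simp
  with step show ?case by (simp add: movement_Suc)
qed

lemma movement_cong:
  assumes "\<And>j. \<lbrakk>l \<le> j; j \<le> t\<rbrakk> \<Longrightarrow> w j = w' j"
  shows "movement w l t = movement w' l t"
  unfolding movement_def using assms by (intro sum.cong) auto

lemma epoch_start_bounds:
  "1 \<le> t \<Longrightarrow> 1 \<le> epoch_start c S w t \<and> epoch_start c S w t \<le> t"
  by (induction c S w t rule: epoch_start.induct) (auto simp: Let_def)

lemma epoch_start_Suc:
  "1 \<le> t \<Longrightarrow> epoch_start c S w (Suc t) =
     (if within_threshold c S (movement w (epoch_start c S w t) (Suc t))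
      then epoch_start c S w t else Suc t)"
  by (cases t) (simp_all add: Let_def)

lemma epoch_start_cong:
  assumes "\<And>j. \<lbrakk>1 \<le> j; j \<le> t\<rbrakk> \<Longrightarrow> w j = w' j"
  shows "epoch_start c S w t = epoch_start c S w' t"
proof (cases "t = 0")
  case False
  then have "1 \<le> t" by simp
  then show ?thesis using assms
  proof (induction rule: dec_induct)
    case base
    show ?case by simp
  next
    case (step n)
    then have eq: "epoch_start c S w n = epoch_start c S w' n" by simp
    have "movement w (epoch_start c S w' n) (Suc n) = movement w' (epoch_start c S w' n) (Suc n)"
      using step epoch_start_bounds[of n c S w'] by (intro movement_cong) auto
    with eq step.hyps show ?case by (simp add: epoch_start_Suc)
  qed
qed simp

text \<open>Causality: an action reads only the losses of strictly earlier rounds. This makes it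
  legitimate to choose the vectors recursively although the actions depend on them.\<close>

lemma actions_cong:
  assumes "\<And>s. \<lbrakk>1 \<le> s; s < t\<rbrakk> \<Longrightarrow> f s = g s"
  shows "actions A f t = actions A g t"
  using assms
proof (induction t rule: less_induct)
  case (less t)
  then have "map f [1..<t] = map g [1..<t]"
    and "map (\<lambda>s. actions A f s) [1..<t] = map (\<lambda>s. actions A g s) [1..<t]"
    by auto
  then show ?case
    by (simp only: actions.simps[of A f t] actions.simps[of A g t])
qed

section \<open>The adversary\<close>

text \<open>Two dimensions leave a nonzero direction orthogonal to \<open>x\<close>; after
  rescaling, one of \<open>y\<close> and \<open>- y\<close> has the required sign against
  \<open>s\<close>.\<close>

lemma orthogonal_vector_of_norm:
  fixes x s :: "'v::euclidean_space"
  assumes "DIM('v) \<ge> 2" and "G \<ge> 0"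
  obtains y where "norm y = G" "y \<bullet> x = 0" "y \<bullet> s \<ge> 0"
proof -
  obtain z where z: "z \<noteq> 0" "orthogonal x z"
    using orthogonal_to_vector_exists[OF assms(1)] by blast
  define y where "y = (G / norm z) *\<^sub>R z"
  have y: "norm y = G" "y \<bullet> x = 0"
    using z assms(2) by (simp_all add: y_def orthogonal_def inner_commute)
  show thesis
  proof (cases "y \<bullet> s \<ge> 0")
    case True
    with y that show ?thesis by blast
  next
    case False
    with y that[of "- y"] show ?thesis by simp
  qed
qed

lemma adversary_policy_exists:
  fixes A :: "'v::euclidean_space player"
  assumes dim: "DIM('v) \<ge> 2" and "G \<ge> 0"
  obtains m where "follows_adversary_policy c G S T (actions A (\<lambda>t u. m t \<bullet> u)) m"
proof -
  let ?w = "\<lambda>m. actions A (\<lambda>t u. m t \<bullet> u)"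
  \<comment> \<open>The choice principle ranges over all naturals, so round 0 and the rounds after
    \<open>T\<close> get vectors as well; round 0 is constrained only in norm.\<close>
  define P where "P m t r \<longleftrightarrow> norm r = G \<and> (t = 1 \<longrightarrow> r \<bullet> ?w m 1 = 0) \<and>
    (t \<ge> 2 \<longrightarrow>
       (if within_threshold c S (movement (?w m) (epoch_start c S (?w m) (t - 1)) t)
        then r = m (t - 1)
        else r \<bullet> ?w m t \<ge> 0 \<and> r \<bullet> (\<Sum>j=1..t-1. m j) \<ge> 0))" for m :: "nat \<Rightarrow> 'v" and t r
  have "\<exists>m. \<forall>t. P m t (m t)"
  proof (rule dependent_wf_choice[OF wf_less_than])
    fix m m' :: "nat \<Rightarrow> 'v" and t r
    assume "\<And>z. (z, t) \<in> less_than \<Longrightarrow> m z = m' z"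
    then have eq: "m z = m' z" if "z < t" for z
      using that by simp
    then have w: "?w m s = ?w m' s" if "s \<le> t" for s
      using that by (intro actions_cong) auto
    have "epoch_start c S (?w m) (t - 1) = epoch_start c S (?w m') (t - 1)"
      using w by (intro epoch_start_cong) auto
    moreover have "movement (?w m) l t = movement (?w m') l t" for l
      using w by (intro movement_cong) auto
    moreover have "(\<Sum>j=1..t-1. m j) = (\<Sum>j=1..t-1. m' j)" if "t \<ge> 2"
      using eq that by (intro sum.cong) auto
    ultimately show "P m t r = P m' t r"
      unfolding P_def using eq[of "t - 1"] w by auto
  next
    fix t and m :: "nat \<Rightarrow> 'v"
    assume IH: "\<And>s. (s, t) \<in> less_than \<Longrightarrow> P m s (m s)"
    obtain r where r: "norm r = G" "r \<bullet> ?w m t = 0" "r \<bullet> (\<Sum>j=1..t-1. m j) \<ge> 0"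
      using orthogonal_vector_of_norm[OF assms] by blast
    show "\<exists>r. P m t r"
    proof (cases "t \<ge> 2 \<and>
        within_threshold c S (movement (?w m) (epoch_start c S (?w m) (t - 1)) t)")
      case True
      then have "P m t (m (t - 1))"
        using IH[of "t - 1"] by (simp add: P_def)
      then show ?thesis by blast
    next
      case False
      \<comment> \<open>Orthogonality to the current action serves both the equation of round 1 and
        the inequality at a new epoch.\<close>
      with r have "P m t r" by (auto simp: P_def)
      then show ?thesis by blast
    qed
  qed
  then obtain m where "\<forall>t. P m t (m t)" by blast
  then have "follows_adversary_policy c G S T (?w m) m"
    by (auto simp: P_def follows_adversary_policy_def)
  then show thesis by (rule that)
qed

section \<open>Losses and vector sums along a single play\<close>

locale adversary_play =
  fixes c G S :: real and T :: nat and w m :: "nat \<Rightarrow> 'v::euclidean_space"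
  assumes c_pos: "c > 0" and G_nonneg: "G \<ge> 0" and S_nonneg: "S \<ge> 0" and T_pos: "T \<ge> 1"
    and policy: "follows_adversary_policy c G S T w m"
    and budget: "movement w 1 T \<le> S"
begin

abbreviation start :: "nat \<Rightarrow> nat" where
  "start \<equiv> epoch_start c S w"

text \<open>The sum of squared epoch lengths, accumulated round by round: the odd numbers 1, 3, ...,
  2L - 1 contributed by an epoch of length L add up to the square of L.\<close>

abbreviation epoch_squares :: "nat \<Rightarrow> real" where
  "epoch_squares t \<equiv> (\<Sum>j=1..t. 2 * (real j - real (start j)) + 1)"

lemma norm_m: "t \<in> {1..T} \<Longrightarrow> norm (m t) = G"
  using policy by (simp add: follows_adversary_policy_def)

text \<open>
  If \<open>S = 0\<close> then \<open>c / S = 0\<close> in HOL; the bound still holds, as the player never moves.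
\<close>

lemma movement_le_if_within:
  assumes "within_threshold c S (movement w l t)" "1 \<le> l" "l \<le> t" "t \<le> T"
  shows "movement w l t \<le> c / S"
  using assms budget movement_mono[of 1 l t T w] by (auto simp: within_threshold_def)

lemma m_Suc:
  assumes "1 \<le> t" "Suc t \<le> T"
  shows "if start (Suc t) = start t then m (Suc t) = m t
         else m (Suc t) \<bullet> w (Suc t) \<ge> 0 \<and> m (Suc t) \<bullet> (\<Sum>j=1..t. m j) \<ge> 0"
proof -
  have "Suc t \<in> {2..T}" using assms by auto
  then have "if within_threshold c S (movement w (start (Suc t - 1)) (Suc t))
     then m (Suc t) = m (Suc t - 1)
     else m (Suc t) \<bullet> w (Suc t) \<ge> 0 \<and> m (Suc t) \<bullet> (\<Sum>j=1..Suc t-1. m j) \<ge> 0"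
    using policy unfolding follows_adversary_policy_def by blast
  then show ?thesis
    using epoch_start_Suc[OF assms(1), of c S w] epoch_start_bounds[OF assms(1), of c S w]
    by (auto split: if_splits)
qed

text \<open>At an epoch start these are the policy's own conditions or trivial. Within an epoch the
  vector is repeated, so each further round adds \<open>m t \<bullet> m t = G\<^sup>2\<close> to its
  product with the past.\<close>

lemma epoch_invariants:
  assumes "1 \<le> t" "t \<le> T"
  shows "m t \<bullet> w (start t) \<ge> 0"
    and "m t \<bullet> (\<Sum>j=1..t-1. m j) \<ge> G\<^sup>2 * (real t - real (start t))"
    and "movement w (start t) t \<le> c / S"
proof -
  have "m t \<bullet> w (start t) \<ge> 0 \<and>
    m t \<bullet> (\<Sum>j=1..t-1. m j) \<ge> G\<^sup>2 * (real t - real (start t)) \<and>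
    movement w (start t) t \<le> c / S"
    using assms
  proof (induction rule: dec_induct)
    case base
    have "m 1 \<bullet> w 1 = 0" using policy by (simp add: follows_adversary_policy_def)
    then show ?case using c_pos S_nonneg by simp
  next
    case (step t)
    then have IH: "m t \<bullet> w (start t) \<ge> 0"
      "m t \<bullet> (\<Sum>j=1..t-1. m j) \<ge> G\<^sup>2 * (real t - real (start t))" by auto
    note b = epoch_start_bounds[OF step.hyps(1), of c S w]
    note s = m_Suc[OF step.hyps(1) step.prems]
    show ?case
    proof (cases "start (Suc t) = start t")
      case True
      with s have m: "m (Suc t) = m t" by simp
      have "within_threshold c S (movement w (start t) (Suc t))"
        using True b by (auto simp: epoch_start_Suc[OF step.hyps(1)] split: if_splits)
      then have mv: "movement w (start t) (Suc t) \<le> c / S"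
        using b step.prems by (intro movement_le_if_within) auto
      have "(\<Sum>j=1..t. m j) = (\<Sum>j=1..t-1. m j) + m t"
        using step.hyps(1) by (cases t) auto
      moreover have "m t \<bullet> m t = G\<^sup>2"
        using norm_m[of t] step by (simp add: power2_norm_eq_inner[symmetric])
      ultimately have "m t \<bullet> (\<Sum>j=1..t. m j) \<ge> G\<^sup>2 * (real (Suc t) - real (start t))"
        using IH(2) by (simp add: inner_add_right algebra_simps)
      then show ?thesis using True m mv IH(1) by simp
    next
      case False
      then have "start (Suc t) = Suc t"
        by (simp add: epoch_start_Suc[OF step.hyps(1)] split: if_splits)
      then show ?thesis using False s c_pos S_nonneg by simp
    qed
  qed
  then show "m t \<bullet> w (start t) \<ge> 0"
    and "m t \<bullet> (\<Sum>j=1..t-1. m j) \<ge> G\<^sup>2 * (real t - real (start t))"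
    and "movement w (start t) t \<le> c / S" by auto
qed

lemma loss_ge:
  assumes "1 \<le> t" "t \<le> T"
  shows "m t \<bullet> w t \<ge> - (G * (c / S))"
proof -
  note inv = epoch_invariants[OF assms]
  have "norm (w t - w (start t)) \<le> c / S"
    using norm_diff_le_movement[of "start t" t w] epoch_start_bounds[OF assms(1)] inv(3)
    by (meson order_trans)
  then have "norm (m t) * norm (w t - w (start t)) \<le> G * (c / S)"
    using norm_m[of t] assms G_nonneg mult_left_mono by fastforce
  then have "\<bar>m t \<bullet> (w t - w (start t))\<bar> \<le> G * (c / S)"
    using Cauchy_Schwarz_ineq2 order_trans by blast
  then show ?thesis using inv(1) by (simp add: inner_diff_right)
qed

lemma sum_loss_ge: "(\<Sum>t=1..T. m t \<bullet> w t) \<ge> - (real T * (G * (c / S)))"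
  using sum_mono[of "{1..T}" "\<lambda>t. - (G * (c / S))" "\<lambda>t. m t \<bullet> w t"] loss_ge by simp

text \<open>In the expansion of the squared norm, the cross term with the past and the new square
  together give at least \<open>G\<^sup>2\<close> times the next summand of
  \<open>epoch_squares\<close>.\<close>

lemma norm_sum_ge:
  "t \<le> T \<Longrightarrow> G\<^sup>2 * epoch_squares t \<le> (norm (\<Sum>j=1..t. m j))\<^sup>2"
proof (induction t)
  case 0
  show ?case by simp
next
  case (Suc t)
  have "m (Suc t) \<bullet> m (Suc t) = G\<^sup>2"
    using norm_m[of "Suc t"] Suc.prems by (simp add: power2_norm_eq_inner[symmetric])
  moreover have "m (Suc t) \<bullet> (\<Sum>j=1..t. m j) \<ge> G\<^sup>2 * (real (Suc t) - real (start (Suc t)))"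
    using epoch_invariants(2)[of "Suc t"] Suc.prems by simp
  ultimately show ?case
    using Suc by (simp add: power2_norm_eq_inner inner_add_left inner_add_right
        inner_commute algebra_simps)
qed

text \<open>
  The tangent inequality \<open>L\<^sup>2 \<ge> 2 a L - a\<^sup>2\<close> is applied to each finished epoch; instead of
  counting the finished epochs, the bound charges the movement that each of them consumed.
\<close>

lemma epoch_squares_invariant:
  assumes "1 \<le> t" "t \<le> T"
  shows "epoch_squares t \<ge> (real t - real (start t) + 1)\<^sup>2 + 2 * a * (real (start t) - 1)
           - a\<^sup>2 * (S / c * movement w 1 (start t))"
  using assms
proof (induction rule: dec_induct)
  case base
  show ?case by simp
next
  case (step t)
  note b = epoch_start_bounds[OF step.hyps(1), of c S w]
  define L where "L = real t - real (start t) + 1"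
  have IH: "epoch_squares t \<ge> L\<^sup>2 + 2 * a * (real (start t) - 1)
      - a\<^sup>2 * (S / c * movement w 1 (start t))"
    using step by (simp add: L_def)
  show ?case
  proof (cases "start (Suc t) = start t")
    case True
    have "(real (Suc t) - real (start t) + 1)\<^sup>2 = L\<^sup>2 + (2 * (real (Suc t) - real (start t)) + 1)"
      by (simp add: L_def power2_eq_square algebra_simps)
    then show ?thesis using IH True by simp
  next
    case False
    then have new: "start (Suc t) = Suc t"
      and "\<not> within_threshold c S (movement w (start t) (Suc t))"
      by (auto simp: epoch_start_Suc[OF step.hyps(1)] split: if_splits)
    then have "S > 0" "movement w (start t) (Suc t) > c / S"
      using S_nonneg by (auto simp: within_threshold_def)
    \<comment> \<open>The movement of a finished epoch, including the step into the next one, pays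
      for the \<open>a\<^sup>2\<close> lost in its tangent inequality.\<close>
    then have "1 \<le> S / c * movement w (start t) (Suc t)"
      using c_pos by (simp add: field_simps)
    moreover have "movement w 1 (Suc t) = movement w 1 (start t) + movement w (start t) (Suc t)"
      using b by (simp add: movement_add)
    ultimately have "S / c * movement w 1 (Suc t) \<ge> S / c * movement w 1 (start t) + 1"
      by (simp add: distrib_left)
    then have "a\<^sup>2 * (S / c * movement w 1 (Suc t)) \<ge> a\<^sup>2 * (S / c * movement w 1 (start t) + 1)"
      by (rule mult_left_mono) simp
    moreover have "L\<^sup>2 \<ge> 2 * a * L - a\<^sup>2"
      using zero_le_power2[of "L - a"] by (simp add: power2_diff mult_ac)
    moreover have "2 * a * L + 2 * a * (real (start t) - 1) = 2 * a * real t"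
      by (simp add: L_def algebra_simps)
    ultimately show ?thesis using IH new by (simp add: distrib_left)
  qed
qed

lemma epoch_squares_ge: "epoch_squares T \<ge> (real T)\<^sup>2 / (1 + S\<^sup>2 / c)"
proof -
  define K where "K = 1 + S\<^sup>2 / c"
  \<comment> \<open>The mean length of \<open>K\<close> epochs, which maximises
    \<open>2 * a * real T - a\<^sup>2 * K\<close>. The 1 in \<open>K\<close> accounts for the last
    epoch, which has no completed threshold crossing to charge.\<close>
  define a where "a = real T / K"
  define L where "L = real T - real (start T) + 1"
  have K: "K > 0" using c_pos by (simp add: K_def add_pos_nonneg)
  have "movement w 1 (start T) \<le> S"
    using movement_mono[of 1 1 "start T" T w] epoch_start_bounds[OF T_pos, of c S w] budget by simp
  then have "S / c * movement w 1 (start T) \<le> S / c * S"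
    using S_nonneg c_pos by (intro mult_left_mono) auto
  then have "S / c * movement w 1 (start T) \<le> K - 1"
    by (simp add: K_def power2_eq_square)
  then have "a\<^sup>2 * (S / c * movement w 1 (start T)) \<le> a\<^sup>2 * (K - 1)"
    by (rule mult_left_mono) simp
  moreover have "epoch_squares T \<ge> L\<^sup>2 + 2 * a * (real (start T) - 1)
      - a\<^sup>2 * (S / c * movement w 1 (start T))"
    using epoch_squares_invariant[OF T_pos, of a] by (simp add: L_def)
  moreover have "L\<^sup>2 \<ge> 2 * a * L - a\<^sup>2"
    using zero_le_power2[of "L - a"] by (simp add: power2_diff mult_ac)
  moreover have "2 * a * L + 2 * a * (real (start T) - 1) = 2 * a * real T"
    by (simp add: L_def algebra_simps)
  ultimately have "epoch_squares T \<ge> 2 * a * real T - a\<^sup>2 * K"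
    by (simp add: algebra_simps)
  also have "2 * a * real T - a\<^sup>2 * K = (real T)\<^sup>2 / K"
    using K by (simp add: a_def power2_eq_square)
  finally show ?thesis by (simp add: K_def)
qed

lemma norm_sum_ge_sqrt:
  assumes "x \<le> epoch_squares T"
  shows "norm (\<Sum>t=1..T. m t) \<ge> G * sqrt x"
proof -
  have "G\<^sup>2 * x \<le> (norm (\<Sum>t=1..T. m t))\<^sup>2"
    using norm_sum_ge[of T] mult_left_mono[OF assms, of "G\<^sup>2"] by simp
  then have "sqrt (G\<^sup>2 * x) \<le> norm (\<Sum>t=1..T. m t)"
    by (simp add: real_le_lsqrt)
  then show ?thesis using G_nonneg by (simp add: real_sqrt_mult)
qed

text \<open>A new epoch starts with a nonnegative loss, so negative losses require some epoch to
  have a second round, and that round alone adds 2 to the sum.\<close>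

lemma short_epochs_dichotomy:
  "(\<Sum>t=1..T. m t \<bullet> w t) \<ge> 0 \<and> epoch_squares T \<ge> real T \<or> epoch_squares T \<ge> real T + 2"
proof (cases "\<forall>t\<in>{1..T}. start t = t")
  case True
  then have "m t \<bullet> w t \<ge> 0" if "t \<in> {1..T}" for t
    using epoch_invariants(1)[of t] that by simp
  then have "(\<Sum>t=1..T. m t \<bullet> w t) \<ge> 0" by (rule sum_nonneg)
  moreover have "epoch_squares T = (\<Sum>j=1..T. 1)"
    using True by (intro sum.cong) auto
  ultimately show ?thesis by simp
next
  case False
  then obtain s where s: "s \<in> {1..T}" "start s \<noteq> s" by blast
  have le: "start t \<le> t" if "t \<in> {1..T}" for t
    using epoch_start_bounds[of t c S w] that by simp
  with s have "start s < s" by (meson le_neq_trans)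
  then have "2 \<le> 2 * (real s - real (start s))" by simp
  also have "\<dots> \<le> (\<Sum>j=1..T. 2 * (real j - real (start j)))"
    using s le by (intro member_le_sum) auto
  finally have "epoch_squares T \<ge> real T + 2"
    by (simp add: sum.distrib)
  then show ?thesis by blast
qed

end

section \<open>Regret\<close>

lemma regret_linear_ge:
  fixes m w :: "nat \<Rightarrow> 'v::euclidean_space"
  assumes "D > 0"
  shows "regret D T (\<lambda>t u. m t \<bullet> u) w \<ge>
    (\<Sum>t=1..T. m t \<bullet> w t) + D / 2 * norm (\<Sum>t=1..T. m t)"
proof -
  define M where "M = (\<Sum>t=1..T. m t)"
  \<comment> \<open>The boundary point opposite to \<open>M\<close>; if \<open>M = 0\<close>,
    division by zero yields \<open>u = 0\<close>, which is still feasible.\<close>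
  define u where "u = - (D / 2 / norm M) *\<^sub>R M"
  have u: "u \<in> feasible D" using assms by (simp add: u_def feasible_def)
  have Mu: "M \<bullet> u = - (D / 2 * norm M)"
    by (cases "M = 0") (simp_all add: u_def flip: power2_norm_eq_inner, simp add: power2_eq_square)
  \<comment> \<open>A real infimum is known to lie below the values only for a set bounded below;
    compactness of the ball provides this.\<close>
  have "bdd_below ((\<lambda>u. M \<bullet> u) ` feasible D)"
    unfolding feasible_def
    by (intro bounded_imp_bdd_below compact_imp_bounded compact_continuous_image
        continuous_intros compact_cball)
  then have "(INF u\<in>feasible D. M \<bullet> u) \<le> M \<bullet> u" using u by (rule cINF_lower)
  then show ?thesis
    unfolding regret_def using Mu by (simp add: M_def flip: inner_sum_left)
qed

context adversary_play
begin

lemma regret_ge: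
  assumes "D > 0"
  shows "regret D T (\<lambda>t u. m t \<bullet> u) w \<ge>
    G * real T * (D / 2 / sqrt (1 + S\<^sup>2 / c) - c / S)"
proof -
  have "norm (\<Sum>t=1..T. m t) \<ge> G * (real T / sqrt (1 + S\<^sup>2 / c))"
    using norm_sum_ge_sqrt[OF epoch_squares_ge] by (simp add: real_sqrt_divide)
  then have "D / 2 * norm (\<Sum>t=1..T. m t) \<ge> D / 2 * (G * (real T / sqrt (1 + S\<^sup>2 / c)))"
    using assms by (intro mult_left_mono) auto
  then have "regret D T (\<lambda>t u. m t \<bullet> u) w \<ge>
      D / 2 * (G * (real T / sqrt (1 + S\<^sup>2 / c))) - real T * (G * (c / S))"
    using regret_linear_ge[OF assms, where T = T and m = m and w = w] sum_loss_ge by linarith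
  then show ?thesis by (simp add: algebra_simps)
qed

text \<open>Replacing the root by an upper bound \<open>q\<close> leaves only rational arithmetic
  for the choice of \<open>c\<close>.\<close>

lemma regret_ge_of_sqrt_le:
  assumes "D > 0" "sqrt (1 + S\<^sup>2 / c) \<le> q" "D / 2 / q - c / S \<ge> x"
  shows "regret D T (\<lambda>t u. m t \<bullet> u) w \<ge> G * real T * x"
proof -
  have "sqrt (1 + S\<^sup>2 / c) > 0" using c_pos by (simp add: add_pos_nonneg)
  then have "D / 2 / q \<le> D / 2 / sqrt (1 + S\<^sup>2 / c)"
    using assms by (intro divide_left_mono mult_pos_pos) linarith+
  then have "x \<le> D / 2 / sqrt (1 + S\<^sup>2 / c) - c / S" using assms by linarith
  then have "G * real T * x \<le> G * real T * (D / 2 / sqrt (1 + S\<^sup>2 / c) - c / S)"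
    using G_nonneg by (intro mult_left_mono) auto
  with regret_ge[OF assms(1)] show ?thesis by linarith
qed

text \<open>The hypothesis on \<open>c\<close> makes the worst total of negative losses no larger
  than the gain from having \<open>T + 2\<close> instead of \<open>T\<close> under the root.\<close>

lemma regret_ge_large_budget:
  assumes "D > 0" and c: "real T * (c / S) \<le> D / 2 * (sqrt (real T + 2) - sqrt (real T))"
  shows "regret D T (\<lambda>t u. m t \<bullet> u) w \<ge> 0.5 * D * G * sqrt (real T)"
proof -
  note r = regret_linear_ge[OF assms(1), where T = T and m = m and w = w]
  from short_epochs_dichotomy show ?thesis
  proof
    assume *: "(\<Sum>t=1..T. m t \<bullet> w t) \<ge> 0 \<and> epoch_squares T \<ge> real T"
    then have "D / 2 * norm (\<Sum>t=1..T. m t) \<ge> D / 2 * (G * sqrt (real T))"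
      using assms norm_sum_ge_sqrt by (intro mult_left_mono) auto
    then show ?thesis using r * by simp
  next
    assume "epoch_squares T \<ge> real T + 2"
    then have "D / 2 * norm (\<Sum>t=1..T. m t) \<ge> D / 2 * (G * sqrt (real T + 2))"
      using assms norm_sum_ge_sqrt by (intro mult_left_mono) auto
    moreover have "G * (real T * (c / S)) \<le> G * (D / 2 * (sqrt (real T + 2) - sqrt (real T)))"
      using c G_nonneg by (intro mult_left_mono) auto
    ultimately show ?thesis using r sum_loss_ge by (simp add: algebra_simps)
  qed
qed

end

section \<open>Choice of the threshold parameter\<close>

lemma threshold_parameter_exists:
  fixes D S :: real
  assumes "D > 0" "S \<ge> 0" "T \<ge> 1"
  shows "\<exists>c>0. \<forall>G (m :: nat \<Rightarrow> 'v::euclidean_space) w. adversary_play c G S T w m \<longrightarrow>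
           (S \<in> {D * sqrt (real T)..D * real T} \<longrightarrow>
              regret D T (\<lambda>t u. m t \<bullet> u) w \<ge> 0.5 * D * G * sqrt (real T)) \<and>
           (S \<in> {D..<D * sqrt (real T)} \<longrightarrow>
              regret D T (\<lambda>t u. m t \<bullet> u) w \<ge> 0.05 * D * G * (D * real T / S)) \<and>
           (S \<in> {0..<D} \<longrightarrow>
              regret D T (\<lambda>t u. m t \<bullet> u) w \<ge> 0.05 * D * G * real T)"
    (is "\<exists>c>0. \<forall>G m w. ?play c G m w \<longrightarrow> ?bounds G m w")
proof -
  have DT: "D \<le> D * sqrt (real T)" using assms by simp
  consider "S \<ge> D * sqrt (real T)" | "D \<le> S" "S < D * sqrt (real T)" | "0 < S" "S < D" | "S = 0"
    using assms by linarith
  then show ?thesis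
  proof cases
    case 1
    then have S: "S > 0" using DT assms by linarith
    \<comment> \<open>Solves the condition of \<open>regret_ge_large_budget\<close> with
      equality.\<close>
    define c where "c = S * (D / 2 * (sqrt (real T + 2) - sqrt (real T))) / real T"
    have c: "c > 0" using S assms by (simp add: c_def)
    have eq: "real T * (c / S) = D / 2 * (sqrt (real T + 2) - sqrt (real T))"
      using S assms by (simp add: c_def)
    have "?bounds G m w" if "?play c G m w" for G m w
      using adversary_play.regret_ge_large_budget[OF that assms(1) eq_refl[OF eq]] 1 DT by auto
    with c show ?thesis by blast
  next
    case 2
    have "D\<^sup>2 \<le> S\<^sup>2" using 2 assms by (intro power_mono) auto
    then have "1 \<le> S\<^sup>2 / D\<^sup>2" using assms by simp
    \<comment> \<open>With 15 the left side is at most 16 times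
      \<open>S\<^sup>2 / D\<^sup>2\<close>, a perfect square; the final constant is 1/8 - 1/15 =
      7/120, above 0.05.\<close>
    then have "1 + S\<^sup>2 / (D\<^sup>2 / 15) \<le> (4 * S / D)\<^sup>2"
      by (simp add: power_divide power_mult_distrib)
    then have q: "sqrt (1 + S\<^sup>2 / (D\<^sup>2 / 15)) \<le> 4 * S / D"
      using 2 assms by (intro real_le_lsqrt) auto
    have x: "D / 2 / (4 * S / D) - D\<^sup>2 / 15 / S \<ge> 0.05 * D * D / S"
      using 2 assms by (simp add: field_simps power2_eq_square)
    have "?bounds G m w" if "?play (D\<^sup>2 / 15) G m w" for G m w
      using adversary_play.regret_ge_of_sqrt_le[OF that assms(1) q x] 2 by (auto simp: mult_ac)
    moreover have "D\<^sup>2 / 15 > 0" using assms by simp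
    ultimately show ?thesis by blast
  next
    case 3
    \<comment> \<open>Here the threshold \<open>c / S\<close> is \<open>D / 15\<close> and
      \<open>S < D\<close> bounds the left side by 1 + 15; the constant is again 1/8 - 1/15.\<close>
    have "1 + S\<^sup>2 / (S * D / 15) \<le> 4\<^sup>2"
      using 3 assms by (simp add: field_simps power2_eq_square)
    then have q: "sqrt (1 + S\<^sup>2 / (S * D / 15)) \<le> 4"
      by (intro real_le_lsqrt) auto
    have lt: "S < D * sqrt (real T)" using 3 DT by linarith
    have x: "D / 2 / 4 - S * D / 15 / S \<ge> 0.05 * D"
      using 3 assms by simp
    have "?bounds G m w" if "?play (S * D / 15) G m w" for G m w
      using adversary_play.regret_ge_of_sqrt_le[OF that assms(1) q x] 3 lt by (auto simp: mult_ac)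
    moreover have "S * D / 15 > 0" using 3 assms by simp
    ultimately show ?thesis by blast
  next
    case 4
    \<comment> \<open>Any positive \<open>c\<close> would do: \<open>1 / S\<close> is 0 in HOL, so
      the penalty vanishes and there is a single epoch.\<close>
    have q: "sqrt (1 + S\<^sup>2 / 1) \<le> 1" and x: "D / 2 / 1 - 1 / S \<ge> 0.05 * D"
      using 4 assms by simp_all
    have "?bounds G m w" if "?play 1 G m w" for G m w
      using adversary_play.regret_ge_of_sqrt_le[OF that assms(1) q x] 4 assms
      by (auto simp: mult_ac mult_le_0_iff)
    then show ?thesis using zero_less_one by blast
  qed
qed

theorem theorem3:
  fixes D G S :: real and T :: nat and A :: "(real ^ 'n) player"
  assumes "CARD('n) \<ge> 2" and "T \<ge> 1" and "D > 0" and "G > 0"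
    and "S \<in> {0..D * real T}"
    and "budgeted_player D S T A"
  shows "\<exists>c>0. \<exists>(m :: nat \<Rightarrow> real ^ 'n) f w.
           f = (\<lambda>t u. m t \<bullet> u) \<and>
           w = actions A f \<and>
           follows_adversary_policy c G S T w m \<and>
           (\<forall>t\<in>{1..T}. \<forall>u\<in>feasible D. \<exists>g. GDERIV (f t) u :> g \<and> norm g \<le> G) \<and>
           (S \<in> {D * sqrt (real T)..D * real T} \<longrightarrow>
              regret D T f w \<ge> 0.5 * D * G * sqrt (real T)) \<and>
           (S \<in> {D..<D * sqrt (real T)} \<longrightarrow>
              regret D T f w \<ge> 0.05 * D * G * (D * real T / S)) \<and>
           (S \<in> {0..<D} \<longrightarrow>
              regret D T f w \<ge> 0.05 * D * G * real T)"
proof -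
  have S: "S \<ge> 0" and dim: "DIM(real ^ 'n) \<ge> 2" and G: "G \<ge> 0" using assms by auto
  obtain c where c: "c > 0"
    and bounds: "\<And>G (m :: nat \<Rightarrow> real ^ 'n) w. adversary_play c G S T w m \<Longrightarrow>
           (S \<in> {D * sqrt (real T)..D * real T} \<longrightarrow>
              regret D T (\<lambda>t u. m t \<bullet> u) w \<ge> 0.5 * D * G * sqrt (real T)) \<and>
           (S \<in> {D..<D * sqrt (real T)} \<longrightarrow>
              regret D T (\<lambda>t u. m t \<bullet> u) w \<ge> 0.05 * D * G * (D * real T / S)) \<and>
           (S \<in> {0..<D} \<longrightarrow>
              regret D T (\<lambda>t u. m t \<bullet> u) w \<ge> 0.05 * D * G * real T)"
    using threshold_parameter_exists[OF \<open>D > 0\<close> S \<open>T \<ge> 1\<close>] by metis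
  obtain m :: "nat \<Rightarrow> real ^ 'n"
    where m: "follows_adversary_policy c G S T (actions A (\<lambda>t u. m t \<bullet> u)) m"
    using adversary_policy_exists[OF dim G] by blast
  let ?f = "\<lambda>t u. m t \<bullet> u"
  \<comment> \<open>The player's budget is promised for convex losses only.\<close>
  have "convex_on (feasible D) (?f t)" for t
    by (rule convex_onI) (simp_all add: feasible_def inner_add_right)
  then have "movement (actions A ?f) 1 T \<le> S"
    using assms(6) by (simp add: budgeted_player_def)
  with c G S m \<open>T \<ge> 1\<close> have "adversary_play c G S T (actions A ?f) m"
    by unfold_locales
  note b = bounds[OF this]
  have "GDERIV (?f t) u :> m t" for t u
    unfolding gderiv_def
    by (rule has_derivative_eq_rhs, (rule derivative_intros)+) (simp add: inner_commute)
  moreover have "norm (m t) \<le> G" if "t \<in> {1..T}" for t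
    using m that by (simp add: follows_adversary_policy_def)
  ultimately have "\<forall>t\<in>{1..T}. \<forall>u\<in>feasible D. \<exists>g. GDERIV (?f t) u :> g \<and> norm g \<le> G"
    by blast
  with c m b show ?thesis by blast
qed

end
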